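(* Let $B=(x,y,z)$ be a point of the Heisenberg group with the Lorentzian metric $\mathbb H^1_L$ such that $-x^2+y^2>0$ and $-1<\frac{4z}{-x^2+y^2}<1$. Then there is a unique spacelike geodesic joining $O=(0,0,0)$ with the point $B$. Let $\theta$ satisfy the equation $$\frac{4z}{-x^2+y^2}=\frac{|\theta|/2}{\sinh^2(|\theta|/2)}-\coth(|\theta|/2).$$ Then the equations of spacelike geodesics $\gamma=(x(t),y(t),z(t)):[0,1]\to\mathbb H^1_L$ are $$x(t)=\sinh^2\!\big(\tfrac{|\theta|}{2}t\big)\Big(x\big(\coth(\tfrac{|\theta|}{2}t)\coth(\tfrac{|\theta|}{2})-1\big)+y\big(\coth(\tfrac{|\theta|}{2}t)-\coth(\tfrac{|\theta|}{2})\big)\Big),$$ $$y(t)=\sinh^2\!\big(\tfrac{|\theta|}{2}t\big)\Big(y\big(\coth(\tfrac{|\theta|}{2}t)\coth(\tfrac{|\theta|}{2})-1\big)+x\big(\coth(\tfrac{|\theta|}{2}t)-\coth(\tfrac{|\theta|}{2})\big)\Big),$$ $$z(t)=z\,\frac{|\theta|t-\sinh(|\theta|t)}{|\theta|-\sinh(|\theta|)}.$$ The square of the length of these geodesics is $$l^2=\theta^2\,\frac{\|h(1)\|^2+4|z|}{2\Big(\big||\theta|-\sinh(|\theta|)\big|+2\sinh^2(|\theta|/2)\Big)},$$ where $\|h(t)\|^2=-x^2(t)+y^2(t)$, so that $\|h(1)\|^2=-x^2+y^2$.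
   Context: The Heisenberg group with the Lorentzian metric, $\mathbb H^1_L$, is $\mathbb R^3$ with coordinates $(x,y,z)$, the horizontal bundle spanned by $$X=\partial_x+\tfrac12 y\,\partial_z,\qquad Y=\partial_y-\tfrac12 x\,\partial_z,$$ and the Lorentzian metric $Q$ on it given by $Q(X,X)=-1$, $Q(Y,Y)=1$, $Q(X,Y)=0$. A horizontal vector $v$ is spacelike if $Q(v,v)>0$ or $v=0$; a curve is spacelike if its tangent vectors are. A geodesic is the projection to $(x,y,z)$-space of a solution of the Hamiltonian system $\dot x=\partial_\xi H$, $\dot y=\partial_\eta H$, $\dot z=\partial_\theta H$, $\dot\xi=-\partial_xH$, $\dot\eta=-\partial_yH$, $\dot\theta=-\partial_zH$ with $$H(\xi,\eta,\theta,x,y,z)=\tfrac12(-\xi^2+\eta^2)-\tfrac18(-x^2+y^2)\theta^2+\tfrac12(-y\xi-x\eta)\theta.$$ Geodesics joining $O$ with $B$ are parametrized on $[0,1]$. The length of a curve $c$ on $[0,1]$ is $\int_0^1|Q(\dot c,\dot c)|^{1/2}dt$. *)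

theory Defs
  imports "HOL-Analysis.Analysis"
begin

(* coth 0 = 0 by x / 0 = 0.  A factor (sinh u)^2 in front of coth u then gives 0 at
   u = 0, which is also the continuous extension. *)
definition coth :: "real \<Rightarrow> real" where
  "coth u = cosh u / sinh u"

type_synonym heis = "real \<times> real \<times> real"

definition frame_X :: "heis \<Rightarrow> heis" where
  "frame_X = (\<lambda>(x, y, z). (1, 0, y / 2))"

definition frame_Y :: "heis \<Rightarrow> heis" where
  "frame_Y = (\<lambda>(x, y, z). (0, 1, - x / 2))"

definition horizontal :: "heis \<Rightarrow> heis set" where
  "horizontal p = span {frame_X p, frame_Y p}"

(* The metric is only meaningful on horizontal vectors.  There the first two
   coordinates are the coefficients with respect to the frame X, Y at any base
   point, so the base point can be omitted; see lorentz_frame. *)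
definition lorentz :: "heis \<Rightarrow> heis \<Rightarrow> real" where
  "lorentz = (\<lambda>(v1, v2, v3) (w1, w2, w3). - (v1 * w1) + v2 * w2)"

lemma lorentz_frame:
  "lorentz (a *\<^sub>R frame_X p + b *\<^sub>R frame_Y p) (c *\<^sub>R frame_X p + d *\<^sub>R frame_Y p)
    = - (a * c) + b * d"
  by (cases p) (simp add: lorentz_def frame_X_def frame_Y_def)

definition spacelike_vector :: "heis \<Rightarrow> heis \<Rightarrow> bool" where
  "spacelike_vector p v \<longleftrightarrow> v \<in> horizontal p \<and> (lorentz v v > 0 \<or> v = 0)"

definition spacelike_curve :: "(real \<Rightarrow> heis) \<Rightarrow> bool" where
  "spacelike_curve \<gamma> \<longleftrightarrow>
    (\<forall>t\<in>{0..1}. \<exists>v. (\<gamma> has_vector_derivative v) (at t within {0..1}) \<and>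
                   spacelike_vector (\<gamma> t) v)"

definition hamiltonian :: "real \<Rightarrow> real \<Rightarrow> real \<Rightarrow> real \<Rightarrow> real \<Rightarrow> real \<Rightarrow> real" where
  "hamiltonian \<xi> \<eta> \<theta> x y z =
     1/2 * (- (\<xi>\<^sup>2) + \<eta>\<^sup>2) - 1/8 * (- (x\<^sup>2) + y\<^sup>2) * \<theta>\<^sup>2 + 1/2 * (- (y * \<xi>) - x * \<eta>) * \<theta>"

definition hamilton_system ::
  "(real \<Rightarrow> real) \<Rightarrow> (real \<Rightarrow> real) \<Rightarrow> (real \<Rightarrow> real) \<Rightarrow>
   (real \<Rightarrow> real) \<Rightarrow> (real \<Rightarrow> real) \<Rightarrow> (real \<Rightarrow> real) \<Rightarrow> bool" where
  "hamilton_system \<xi> \<eta> \<theta> x y z \<longleftrightarrow> (\<forall>t\<in>{0..1}.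
     (x has_real_derivative deriv (\<lambda>s. hamiltonian s (\<eta> t) (\<theta> t) (x t) (y t) (z t)) (\<xi> t))
        (at t within {0..1}) \<and>
     (y has_real_derivative deriv (\<lambda>s. hamiltonian (\<xi> t) s (\<theta> t) (x t) (y t) (z t)) (\<eta> t))
        (at t within {0..1}) \<and>
     (z has_real_derivative deriv (\<lambda>s. hamiltonian (\<xi> t) (\<eta> t) s (x t) (y t) (z t)) (\<theta> t))
        (at t within {0..1}) \<and>
     (\<xi> has_real_derivative - deriv (\<lambda>s. hamiltonian (\<xi> t) (\<eta> t) (\<theta> t) s (y t) (z t)) (x t))
        (at t within {0..1}) \<and>
     (\<eta> has_real_derivative - deriv (\<lambda>s. hamiltonian (\<xi> t) (\<eta> t) (\<theta> t) (x t) s (z t)) (y t))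
        (at t within {0..1}) \<and>
     (\<theta> has_real_derivative - deriv (\<lambda>s. hamiltonian (\<xi> t) (\<eta> t) (\<theta> t) (x t) (y t) s) (z t))
        (at t within {0..1}))"

definition geodesic :: "(real \<Rightarrow> heis) \<Rightarrow> bool" where
  "geodesic \<gamma> \<longleftrightarrow>
    (\<exists>\<xi> \<eta> \<theta> x y z. hamilton_system \<xi> \<eta> \<theta> x y z \<and> (\<forall>t\<in>{0..1}. \<gamma> t = (x t, y t, z t)))"

definition spacelike_geodesic_joining :: "heis \<Rightarrow> heis \<Rightarrow> (real \<Rightarrow> heis) \<Rightarrow> bool" where
  "spacelike_geodesic_joining A B \<gamma> \<longleftrightarrow>
    geodesic \<gamma> \<and> spacelike_curve \<gamma> \<and> \<gamma> 0 = A \<and> \<gamma> 1 = B"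

definition curve_length :: "(real \<Rightarrow> heis) \<Rightarrow> real" where
  "curve_length \<gamma> =
    integral {0..1} (\<lambda>t. sqrt \<bar>lorentz (vector_derivative \<gamma> (at t within {0..1}))
                                      (vector_derivative \<gamma> (at t within {0..1}))\<bar>)"

definition h_normsq :: "heis \<Rightarrow> real" where
  "h_normsq = (\<lambda>(x, y, z). - (x\<^sup>2) + y\<^sup>2)"

end

theory Submission
  imports Defs "HOL-Real_Asymp.Real_Asymp"
begin

text \<open>
  The Hamiltonian system makes \<open>\<theta>\<close> constant and turns the velocity \<open>(u, v) = (x', y')\<close>
  into a solution of \<open>u' = - \<theta> v\<close>, \<open>v' = - \<theta> u\<close>, so every geodesic from the origin is
  determined by \<open>\<theta>\<close> and its initial velocity \<open>(a, b)\<close>.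
  Then \<open>4 z(1) / (- x(1)\<^sup>2 + y(1)\<^sup>2) = (\<theta> - sinh \<theta>) / (cosh \<theta> - 1)\<close>, and the right-hand side
  is an odd, strictly decreasing bijection from the line onto \<open>(-1, 1)\<close>.  Hence the end point
  determines \<open>\<theta>\<close>, and with \<open>\<theta>\<close> known \<open>(a, b)\<close> is the solution of a linear system with
  positive determinant.  The speed is constant and equal to \<open>sqrt (b\<^sup>2 - a\<^sup>2)\<close>.
\<close>

section \<open>The ratio at the end point\<close>

lemma cosh_minus_one_half:
  fixes \<theta> :: real
  shows "cosh \<theta> - 1 = 2 * (sinh (\<theta> / 2))\<^sup>2"
  using cosh_double[of "\<theta> / 2"] by (simp add: cosh_square_eq)

lemma sinh_half:
  fixes \<theta> :: real
  shows "sinh \<theta> = 2 * sinh (\<theta> / 2) * cosh (\<theta> / 2)"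
  using sinh_double[of "\<theta> / 2"] by simp

lemma cosh_gt_one:
  fixes \<theta> :: real
  assumes "\<theta> \<noteq> 0"
  shows "1 < cosh \<theta>"
proof -
  have "0 < (sinh (\<theta> / 2))\<^sup>2" using assms by simp
  then show ?thesis using cosh_minus_one_half[of \<theta>] by linarith
qed

lemma less_sinh:
  fixes \<theta> :: real
  assumes "0 < \<theta>"
  shows "\<theta> < sinh \<theta>"
proof -
  have "(\<lambda>s. sinh s - s) 0 < (\<lambda>s. sinh s - s) \<theta>"
  proof (rule DERIV_pos_imp_increasing_open[OF assms])
    fix s :: real assume s: "0 < s" "s < \<theta>"
    have "((\<lambda>s. sinh s - s) has_real_derivative cosh s - 1) (at s)"
      by (auto intro!: derivative_eq_intros)
    then show "\<exists>y. ((\<lambda>s. sinh s - s) has_real_derivative y) (at s) \<and> 0 < y"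
      using cosh_gt_one[of s] s by force
  qed (intro continuous_intros)
  then show ?thesis by simp
qed

text \<open>The difference of the two sides vanishes at 0 and has derivative
  \<open>s * sinh s\<close>. Taken at half the parameter, the inequality decides the sign of the
  derivative of \<open>end_ratio\<close>.\<close>

lemma sinh_less_mult_cosh:
  fixes p :: real
  assumes "0 < p"
  shows "sinh p < p * cosh p"
proof -
  have "(\<lambda>s. s * cosh s - sinh s) 0 < (\<lambda>s. s * cosh s - sinh s) p"
  proof (rule DERIV_pos_imp_increasing_open[OF assms])
    fix s :: real assume s: "0 < s" "s < p"
    have "((\<lambda>s. s * cosh s - sinh s) has_real_derivative s * sinh s) (at s)"
      by (auto intro!: derivative_eq_intros)
    then show "\<exists>y. ((\<lambda>s. s * cosh s - sinh s) has_real_derivative y) (at s) \<and> 0 < y"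
      using s by (intro exI[of _ "s * sinh s"]) simp
  qed (intro continuous_intros)
  then show ?thesis by simp
qed

section \<open>Monotonicity and range of the ratio\<close>

definition end_ratio :: "real \<Rightarrow> real" where
  "end_ratio \<theta> = (\<theta> - sinh \<theta>) / (cosh \<theta> - 1)"

text \<open>Here 0 / 0 = 0 agrees with the limit at 0, so \<theta> = 0 needs no separate
  formula.\<close>

lemma end_ratio_0 [simp]: "end_ratio 0 = 0"
  by (simp add: end_ratio_def)

lemma end_ratio_minus: "end_ratio (- \<theta>) = - end_ratio \<theta>"
  by (simp add: end_ratio_def minus_divide_left)

lemma end_ratio_neg: "0 < \<theta> \<Longrightarrow> end_ratio \<theta> < 0"
  unfolding end_ratio_def using less_sinh[of \<theta>] cosh_gt_one[of \<theta>]
  by (intro divide_neg_pos) auto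

lemma end_ratio_pos: "\<theta> < 0 \<Longrightarrow> 0 < end_ratio \<theta>"
  using end_ratio_neg[of "- \<theta>"] by (simp add: end_ratio_minus)

text \<open>By cosh^2 - sinh^2 = 1 the numerator from the quotient rule collapses to 2 (cosh s - 1)
  - s sinh s. With p = s/2 this is 4 sinh p (sinh p - p cosh p), which is negative by
  \<open>sinh_less_mult_cosh\<close>.\<close>

lemma end_ratio_decreasing:
  assumes "0 < \<theta>" "\<theta> < \<theta>'"
  shows "end_ratio \<theta>' < end_ratio \<theta>"
proof (rule DERIV_neg_imp_decreasing[OF assms(2)])
  fix s assume "\<theta> \<le> s" "s \<le> \<theta>'"
  with assms have s: "0 < s" by simp
  let ?d = "((1 - cosh s) * (cosh s - 1) - (s - sinh s) * sinh s) / ((cosh s - 1) * (cosh s - 1))"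
  have pos: "0 < cosh s - 1" using cosh_gt_one[of s] s by simp
  have der: "(end_ratio has_real_derivative ?d) (at s)"
    unfolding end_ratio_def[abs_def] using pos by (auto intro!: derivative_eq_intros)
  have "4 * sinh (s/2) * sinh (s/2) < 4 * sinh (s/2) * (s/2 * cosh (s/2))"
    using s sinh_less_mult_cosh[of "s/2"] by (intro mult_strict_left_mono) auto
  then have "2 * (cosh s - 1) < s * sinh s"
    unfolding cosh_minus_one_half sinh_half[of s] by (simp add: power2_eq_square mult_ac)
  moreover have "(1 - cosh s) * (cosh s - 1) - (s - sinh s) * sinh s = 2 * (cosh s - 1) - s * sinh s"
    using cosh_square_eq[of s] by (simp add: algebra_simps power2_eq_square)
  ultimately have "?d < 0" using pos by (intro divide_neg_pos) auto
  with der show "\<exists>y. (end_ratio has_real_derivative y) (at s) \<and> y < 0" by blast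
qed

text \<open>The ratio has the sign opposite to that of its argument, so equal values force equal
  signs. Strict monotonicity settles the positive arguments and oddness carries this over to the
  negative ones.\<close>

lemma inj_end_ratio: "inj end_ratio"
proof (rule injI)
  have pos: "s = t" if "0 < s" "0 < t" "end_ratio s = end_ratio t" for s t
    using end_ratio_decreasing that by (metis less_irrefl linorder_neqE)
  fix s t assume eq: "end_ratio s = end_ratio t"
  consider "0 < s" | "s = 0" | "s < 0" by linarith
  then show "s = t"
  proof cases
    case 1
    then have "0 < t"
      using eq end_ratio_neg[of s] end_ratio_pos[of t] by (cases t "0::real" rule: linorder_cases) auto
    then show ?thesis using pos 1 eq by blast
  next
    case 2
    then show ?thesis
      using eq end_ratio_neg[of t] end_ratio_pos[of t] by (cases t "0::real" rule: linorder_cases) auto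
  next
    case 3
    then have "t < 0"
      using eq end_ratio_neg[of t] end_ratio_pos[of s] by (cases t "0::real" rule: linorder_cases) auto
    then show ?thesis using pos[of "- s" "- t"] 3 eq by (simp add: end_ratio_minus)
  qed
qed

text \<open>On the positive half-line the ratio runs from its limit 0 at 0 to its limit -1 at
  infinity, so every negative value is attained by the intermediate value theorem. Oddness gives the
  positive values.\<close>

lemma end_ratio_onto:
  assumes "-1 < r" "r < 1"
  shows "\<exists>\<theta>. end_ratio \<theta> = r"
proof -
  have neg: "\<exists>\<theta>. end_ratio \<theta> = r" if r: "-1 < r" "r < 0" for r
  proof -
    have "(end_ratio \<longlongrightarrow> 0) (at_right 0)"
      unfolding end_ratio_def[abs_def] by real_asymp
    then have "\<forall>\<^sub>F t in at_right 0. r < end_ratio t"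
      using r by (intro order_tendstoD)
    then have "\<forall>\<^sub>F t in at_right 0. 0 < t \<and> r < end_ratio t"
      by (intro eventually_conj eventually_at_right_less)
    then obtain s where s: "0 < s" "r < end_ratio s"
      using eventually_happens'[OF trivial_limit_at_right_real] by blast
    have "(end_ratio \<longlongrightarrow> -1) at_top"
      unfolding end_ratio_def[abs_def] by real_asymp
    then have "\<forall>\<^sub>F t in at_top. end_ratio t < r"
      using r by (intro order_tendstoD)
    then have "\<forall>\<^sub>F t in at_top. end_ratio t < r \<and> s \<le> t"
      by (intro eventually_conj eventually_ge_at_top)
    then obtain t where t: "s \<le> t" "end_ratio t < r"
      using eventually_happens'[OF trivial_limit_at_top_linorder] by blast
    \<comment> \<open>The interval starts at s > 0, which keeps the denominator
      \<open>cosh \<theta> - 1\<close> away from its zero.\<close>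
    have "continuous_on {s..t} end_ratio"
      unfolding end_ratio_def[abs_def] using s cosh_gt_one
      by (intro continuous_intros) force
    then show ?thesis
      using IVT2'[of end_ratio t r s] s t by force
  qed
  consider "r < 0" | "r = 0" | "0 < r" by linarith
  then show ?thesis
  proof cases
    case 3
    then obtain \<theta> where "end_ratio \<theta> = - r" using neg[of "- r"] assms by auto
    then show ?thesis by (metis end_ratio_minus minus_minus)
  qed (use neg assms end_ratio_0 in blast)+
qed

section \<open>Geodesics from the origin\<close>

text \<open>The integral of \<open>cosh (\<theta> * s)\<close> for s from 0 to t. At \<theta> = 0
  division by zero would give 0 instead of the correct t, hence the case distinction.\<close>

definition int_cosh :: "real \<Rightarrow> real \<Rightarrow> real" where
  "int_cosh \<theta> t = (if \<theta> = 0 then t else sinh (\<theta> * t) / \<theta>)"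

text \<open>For \<open>\<theta> = 0\<close> the quotients in \<open>int_sinh\<close> and \<open>area_coeff\<close> are \<open>0\<close>
  by \<open>x / 0 = 0\<close>, which is their limit.\<close>

definition int_sinh :: "real \<Rightarrow> real \<Rightarrow> real" where
  "int_sinh \<theta> t = (cosh (\<theta> * t) - 1) / \<theta>"

definition area_coeff :: "real \<Rightarrow> real \<Rightarrow> real" where
  "area_coeff \<theta> t = (\<theta> * t - sinh (\<theta> * t)) / (2 * \<theta>\<^sup>2)"

lemma int_at_0 [simp]: "int_cosh \<theta> 0 = 0" "int_sinh \<theta> 0 = 0" "area_coeff \<theta> 0 = 0"
  by (simp_all add: int_cosh_def int_sinh_def area_coeff_def)

lemma int_cosh_deriv: "(int_cosh \<theta> has_real_derivative cosh (\<theta> * t)) (at t within S)"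
  unfolding int_cosh_def[abs_def] by (cases "\<theta> = 0") (auto intro!: derivative_eq_intros)

lemma int_sinh_deriv: "(int_sinh \<theta> has_real_derivative sinh (\<theta> * t)) (at t within S)"
  unfolding int_sinh_def[abs_def] by (cases "\<theta> = 0") (auto intro!: derivative_eq_intros)

lemma area_coeff_deriv: "(area_coeff \<theta> has_real_derivative - int_sinh \<theta> t / 2) (at t within S)"
proof (cases "\<theta> = 0")
  case False
  have "((\<lambda>s. (\<theta> * s - sinh (\<theta> * s)) / (2 * \<theta>\<^sup>2)) has_real_derivative
      (\<theta> - cosh (\<theta> * t) * \<theta>) / (2 * \<theta>\<^sup>2)) (at t within S)"
    by (intro DERIV_cdivide) (auto intro!: derivative_eq_intros)
  moreover have "(\<theta> - cosh (\<theta> * t) * \<theta>) / (2 * \<theta>\<^sup>2) = - int_sinh \<theta> t / 2"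
    using False by (simp add: int_sinh_def field_simps power2_eq_square)
  ultimately show ?thesis by (simp add: area_coeff_def[abs_def])
qed (simp add: area_coeff_def[abs_def] int_sinh_def)

text \<open>Multiplied by \<theta>, the left side is cosh (cosh - 1) - sinh^2 = 1 - cosh. This is
  the only relation between the coefficient functions needed to compute z'.\<close>

lemma int_sinh_wronskian:
  "cosh (\<theta> * t) * int_sinh \<theta> t - sinh (\<theta> * t) * int_cosh \<theta> t = - int_sinh \<theta> t"
  using cosh_square_eq[of "\<theta> * t"]
  by (cases "\<theta> = 0") (simp_all add: int_sinh_def int_cosh_def field_simps power2_eq_square)

lemma int_det_eq:
  "\<theta> \<noteq> 0 \<Longrightarrow> (int_cosh \<theta> 1)\<^sup>2 - (int_sinh \<theta> 1)\<^sup>2 = 2 * (cosh \<theta> - 1) / \<theta>\<^sup>2"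
  using cosh_square_eq[of \<theta>]
  by (simp add: int_cosh_def int_sinh_def power_divide field_simps power2_eq_square)

text \<open>This is the determinant of the linear map from the initial velocity (a, b) to (x(1),
  y(1)); its positivity makes that map invertible for every \<theta>.\<close>

lemma int_det_pos: "0 < (int_cosh \<theta> 1)\<^sup>2 - (int_sinh \<theta> 1)\<^sup>2"
  by (cases "\<theta> = 0") (simp_all add: int_det_eq cosh_gt_one, simp add: int_cosh_def int_sinh_def)

text \<open>At time 1 both z and -x^2 + y^2 carry the factor b^2 - a^2. What remains after
  cancelling it depends on \<theta> alone.\<close>

lemma area_coeff_ratio:
  "4 * area_coeff \<theta> 1 / ((int_cosh \<theta> 1)\<^sup>2 - (int_sinh \<theta> 1)\<^sup>2) = end_ratio \<theta>"
proof (cases "\<theta> = 0")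
  case False
  then show ?thesis using cosh_gt_one[OF False]
    by (simp add: int_det_eq area_coeff_def end_ratio_def field_simps)
qed (simp add: area_coeff_def end_ratio_def)

text \<open>The solution from the origin with constant momentum \<theta> and initial horizontal
  velocity (a, b). The first two coordinates integrate a hyperbolic rotation of (a, b).\<close>

definition heis_geodesic :: "real \<Rightarrow> real \<Rightarrow> real \<Rightarrow> real \<Rightarrow> heis" where
  "heis_geodesic \<theta> a b t =
     (a * int_cosh \<theta> t - b * int_sinh \<theta> t,
      b * int_cosh \<theta> t - a * int_sinh \<theta> t,
      (b\<^sup>2 - a\<^sup>2) * area_coeff \<theta> t)"

definition heis_velocity :: "real \<Rightarrow> real \<Rightarrow> real \<Rightarrow> real \<Rightarrow> heis" where
  "heis_velocity \<theta> a b t =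
     (a * cosh (\<theta> * t) - b * sinh (\<theta> * t),
      b * cosh (\<theta> * t) - a * sinh (\<theta> * t),
      - (b\<^sup>2 - a\<^sup>2) * int_sinh \<theta> t / 2)"

lemma heis_geodesic_deriv:
  "(heis_geodesic \<theta> a b has_vector_derivative heis_velocity \<theta> a b t) (at t within S)"
  unfolding heis_geodesic_def[abs_def] heis_velocity_def
  by (intro has_vector_derivative_Pair; subst has_real_derivative_iff_has_vector_derivative[symmetric])
     (auto intro!: derivative_eq_intros int_cosh_deriv int_sinh_deriv area_coeff_deriv
        simp: algebra_simps)

text \<open>The horizontal velocity is (a, b) moved by a hyperbolic rotation, which preserves the
  Lorentzian form.\<close>

lemma lorentz_heis_velocity:
  "lorentz (heis_velocity \<theta> a b t) (heis_velocity \<theta> a b t) = b\<^sup>2 - a\<^sup>2"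
proof -
  have "cosh (\<theta> * t) * cosh (\<theta> * t) = 1 + sinh (\<theta> * t) * sinh (\<theta> * t)"
    using cosh_square_eq[of "\<theta> * t"] by (simp add: power2_eq_square)
  then show ?thesis
    unfolding lorentz_def heis_velocity_def by (simp add: power2_eq_square) algebra
qed

text \<open>The products containing ab cancel, leaving (b^2 - a^2)(c j - s i) / 2. With the curve
  and its velocity inserted, the left side is the z-velocity that horizontality prescribes.\<close>

lemma area_velocity:
  fixes a b c s i j :: real
  assumes "c * j - s * i = - j"
  shows "((a * c - b * s) * (b * i - a * j) - (b * c - a * s) * (a * i - b * j)) / 2
    = - (b\<^sup>2 - a\<^sup>2) * j / 2"
  using assms by algebra

text \<open>The horizontal plane is the kernel of the contact form dz - (y dx - x dy) / 2.\<close>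

lemma horizontal_iff: "(u, v, w) \<in> horizontal (x, y, z) \<longleftrightarrow> w = (u * y - v * x) / 2"
proof
  assume "(u, v, w) \<in> horizontal (x, y, z)"
  then show "w = (u * y - v * x) / 2"
    by (auto simp: horizontal_def frame_X_def frame_Y_def span_insert algebra_simps)
next
  assume w: "w = (u * y - v * x) / 2"
  have "u *\<^sub>R frame_X (x, y, z) + v *\<^sub>R frame_Y (x, y, z) \<in> horizontal (x, y, z)"
    unfolding horizontal_def by (intro span_add span_scale span_base) auto
  moreover have "u *\<^sub>R frame_X (x, y, z) + v *\<^sub>R frame_Y (x, y, z) = (u, v, w)"
    by (simp add: frame_X_def frame_Y_def w diff_divide_distrib)
  ultimately show "(u, v, w) \<in> horizontal (x, y, z)" by simp
qed

lemma heis_velocity_horizontal: "heis_velocity \<theta> a b t \<in> horizontal (heis_geodesic \<theta> a b t)"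
  unfolding heis_velocity_def heis_geodesic_def horizontal_iff
  by (simp only: area_velocity[OF int_sinh_wronskian])

text \<open>Completing squares gives H = (v^2 - u^2) / 2 with u = -(\<xi> + y \<theta> / 2) and v =
  \<eta> - x \<theta> / 2. Hence x' = u and y' = v, and the other right-hand sides are also written
  through these two expressions.\<close>

lemma hamilton_system_iff:
  "hamilton_system \<xi> \<eta> \<theta> x y z \<longleftrightarrow> (\<forall>t\<in>{0..1}.
     (x has_real_derivative - (\<xi> t + y t * \<theta> t / 2)) (at t within {0..1}) \<and>
     (y has_real_derivative \<eta> t - x t * \<theta> t / 2) (at t within {0..1}) \<and>
     (z has_real_derivative
        (- (\<xi> t + y t * \<theta> t / 2) * y t - (\<eta> t - x t * \<theta> t / 2) * x t) / 2) (at t within {0..1}) \<and>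
     (\<xi> has_real_derivative \<theta> t / 2 * (\<eta> t - x t * \<theta> t / 2)) (at t within {0..1}) \<and>
     (\<eta> has_real_derivative \<theta> t / 2 * (\<xi> t + y t * \<theta> t / 2)) (at t within {0..1}) \<and>
     (\<theta> has_real_derivative 0) (at t within {0..1}))"
proof -
  have "((\<lambda>s. hamiltonian s q c p1 p2 p3) has_real_derivative - (p + p2 * c / 2)) (at p)"
    "((\<lambda>s. hamiltonian p s c p1 p2 p3) has_real_derivative q - p1 * c / 2) (at q)"
    "((\<lambda>s. hamiltonian p q s p1 p2 p3) has_real_derivative
       (- (p + p2 * c / 2) * p2 - (q - p1 * c / 2) * p1) / 2) (at c)"
    "((\<lambda>s. hamiltonian p q c s p2 p3) has_real_derivative - (c / 2 * (q - p1 * c / 2))) (at p1)"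
    "((\<lambda>s. hamiltonian p q c p1 s p3) has_real_derivative - (c / 2 * (p + p2 * c / 2))) (at p2)"
    "((\<lambda>s. hamiltonian p q c p1 p2 s) has_real_derivative 0) (at p3)" for p q c p1 p2 p3
    unfolding hamiltonian_def
    by (auto intro!: derivative_eq_intros simp: field_simps power2_eq_square)
  note derivs = this[THEN DERIV_imp_deriv]
  show ?thesis unfolding hamilton_system_def derivs minus_minus minus_zero ..
qed

lemma geodesic_heis_geodesic: "geodesic (heis_geodesic \<theta> a b)"
proof -
  define x where "x t = a * int_cosh \<theta> t - b * int_sinh \<theta> t" for t
  define y where "y t = b * int_cosh \<theta> t - a * int_sinh \<theta> t" for t
  define z where "z t = (b\<^sup>2 - a\<^sup>2) * area_coeff \<theta> t" for t
  define u where "u t = a * cosh (\<theta> * t) - b * sinh (\<theta> * t)" for t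
  define v where "v t = b * cosh (\<theta> * t) - a * sinh (\<theta> * t)" for t
  \<comment> \<open>The momenta come from solving u = -(\<xi> + y \<theta> / 2) and v = \<eta> - x
    \<theta> / 2 for \<xi> and \<eta>.\<close>
  define \<xi> where "\<xi> t = - u t - y t * \<theta> / 2" for t
  define \<eta> where "\<eta> t = v t + x t * \<theta> / 2" for t
  have dx: "(x has_real_derivative u t) (at t within {0..1})"
    and dy: "(y has_real_derivative v t) (at t within {0..1})"
    and dz: "(z has_real_derivative - (b\<^sup>2 - a\<^sup>2) * int_sinh \<theta> t / 2) (at t within {0..1})"
    and du: "(u has_real_derivative - \<theta> * v t) (at t within {0..1})"
    and dv: "(v has_real_derivative - \<theta> * u t) (at t within {0..1})" for t
    unfolding x_def[abs_def] y_def[abs_def] z_def[abs_def] u_def[abs_def] v_def[abs_def]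
    by (auto intro!: derivative_eq_intros int_cosh_deriv int_sinh_deriv area_coeff_deriv
        simp: algebra_simps)
  have d\<xi>: "(\<xi> has_real_derivative \<theta> / 2 * v t) (at t within {0..1})"
    and d\<eta>: "(\<eta> has_real_derivative - \<theta> / 2 * u t) (at t within {0..1})" for t
    unfolding \<xi>_def[abs_def] \<eta>_def[abs_def]
    by (auto intro!: derivative_eq_intros dx dy du dv simp: algebra_simps)
  have "hamilton_system \<xi> \<eta> (\<lambda>_. \<theta>) x y z"
    unfolding hamilton_system_iff
  proof (intro ballI conjI)
    fix t
    have area: "(u t * y t - v t * x t) / 2 = - (b\<^sup>2 - a\<^sup>2) * int_sinh \<theta> t / 2"
      unfolding u_def v_def x_def y_def by (rule area_velocity[OF int_sinh_wronskian])
    show "(z has_real_derivative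
        (- (\<xi> t + y t * \<theta> / 2) * y t - (\<eta> t - x t * \<theta> / 2) * x t) / 2) (at t within {0..1})"
      using dz[of t] unfolding area[symmetric] by (simp add: \<xi>_def \<eta>_def)
  qed (use dx dy d\<xi> d\<eta> in \<open>simp_all add: \<xi>_def \<eta>_def\<close>)
  then show ?thesis
    unfolding geodesic_def heis_geodesic_def x_def[abs_def] y_def[abs_def] z_def[abs_def] by blast
qed

section \<open>Integration of the Hamiltonian system by conserved quantities\<close>

lemma eq_initial_value:
  fixes f :: "real \<Rightarrow> real"
  assumes "\<And>s. s \<in> {0..1} \<Longrightarrow> (f has_real_derivative 0) (at s within {0..1})" "t \<in> {0..1}"
  shows "f t = f 0"
  using has_field_derivative_zero_constant[of "{0..1}" f] assms by force

lemma inverse_hyperbolic_rotation: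
  fixes a b c s u v :: real
  assumes "c\<^sup>2 = s\<^sup>2 + 1" "c * u + s * v = a" "s * u + c * v = b"
  shows "u = a * c - b * s" "v = b * c - a * s"
proof -
  have "c * c = 1 + s * s" using assms(1) by (simp add: power2_eq_square)
  then have "u * (c * c) = u + u * (s * s)" "v * (c * c) = v + v * (s * s)"
    by (simp_all add: distrib_left)
  then show "u = a * c - b * s" "v = b * c - a * s"
    unfolding assms(2,3)[symmetric] by (simp_all add: algebra_simps)
qed

text \<open>Each unknown is determined by exhibiting a quantity with zero derivative: first
  \<theta>, then the velocity rotated back to time 0, and finally the differences between the
  coordinates and their claimed formulas.\<close>

lemma geodesic_from_origin:
  assumes "geodesic \<gamma>" "\<gamma> 0 = (0, 0, 0)"
  obtains \<theta> a b where "\<And>t. t \<in> {0..1} \<Longrightarrow> \<gamma> t = heis_geodesic \<theta> a b t"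
proof -
  from assms(1) obtain \<xi> \<eta> \<Theta> x y z
    where ham: "hamilton_system \<xi> \<eta> \<Theta> x y z" and \<gamma>: "\<forall>t\<in>{0..1}. \<gamma> t = (x t, y t, z t)"
    unfolding geodesic_def by blast
  have init: "x 0 = 0" "y 0 = 0" "z 0 = 0" using \<gamma> assms(2) by auto
  define \<theta> where "\<theta> = \<Theta> 0"
  have \<Theta>: "\<Theta> t = \<theta>" if "t \<in> {0..1}" for t
    unfolding \<theta>_def using that ham by (intro eq_initial_value) (auto simp: hamilton_system_iff)
  define u where "u t = - (\<xi> t + y t * \<theta> / 2)" for t
  define v where "v t = \<eta> t - x t * \<theta> / 2" for t
  define a where "a = u 0"
  define b where "b = v 0"
  have dx: "(x has_real_derivative u t) (at t within {0..1})"
    and dy: "(y has_real_derivative v t) (at t within {0..1})"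
    and dz: "(z has_real_derivative (u t * y t - v t * x t) / 2) (at t within {0..1})"
    and d\<xi>: "(\<xi> has_real_derivative \<theta> / 2 * v t) (at t within {0..1})"
    and d\<eta>: "(\<eta> has_real_derivative - \<theta> / 2 * u t) (at t within {0..1})"
    if "t \<in> {0..1}" for t
    using ham that \<Theta>[OF that] unfolding hamilton_system_iff u_def v_def by (auto simp: algebra_simps)
  \<comment> \<open>Half of each right-hand side comes from the change of the momentum, half from
    the motion of the base point.\<close>
  have du: "(u has_real_derivative - \<theta> * v t) (at t within {0..1})"
    and dv: "(v has_real_derivative - \<theta> * u t) (at t within {0..1})" if "t \<in> {0..1}" for t
    unfolding u_def[abs_def] v_def[abs_def]
    by (rule derivative_eq_intros dx[OF that] dy[OF that] d\<xi>[OF that] d\<eta>[OF that] refl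
        | simp add: u_def v_def field_simps)+
  \<comment> \<open>Applying the inverse hyperbolic rotation to (u, v) undoes the flow u' =
    -\<theta> v, v' = -\<theta> u, so the result keeps its initial value (a, b).\<close>
  have first: "cosh (\<theta> * t) * u t + sinh (\<theta> * t) * v t = a"
    and second: "sinh (\<theta> * t) * u t + cosh (\<theta> * t) * v t = b" if t: "t \<in> {0..1}" for t
  proof -
    have "((\<lambda>t. cosh (\<theta> * t) * u t + sinh (\<theta> * t) * v t) has_real_derivative 0)
        (at s within {0..1})" if "s \<in> {0..1}" for s
      by (rule derivative_eq_intros du[OF that] dv[OF that] refl | simp add: algebra_simps)+
    from eq_initial_value[OF this t] show "cosh (\<theta> * t) * u t + sinh (\<theta> * t) * v t = a"
      by (simp add: a_def)
    have "((\<lambda>t. sinh (\<theta> * t) * u t + cosh (\<theta> * t) * v t) has_real_derivative 0)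
        (at s within {0..1})" if "s \<in> {0..1}" for s
      by (rule derivative_eq_intros du[OF that] dv[OF that] refl | simp add: algebra_simps)+
    from eq_initial_value[OF this t] show "sinh (\<theta> * t) * u t + cosh (\<theta> * t) * v t = b"
      by (simp add: b_def)
  qed
  have u: "u t = a * cosh (\<theta> * t) - b * sinh (\<theta> * t)"
    and v: "v t = b * cosh (\<theta> * t) - a * sinh (\<theta> * t)" if "t \<in> {0..1}" for t
    using inverse_hyperbolic_rotation[OF cosh_square_eq first[OF that] second[OF that]] by simp_all
  have x: "x t = a * int_cosh \<theta> t - b * int_sinh \<theta> t"
    and y: "y t = b * int_cosh \<theta> t - a * int_sinh \<theta> t" if t: "t \<in> {0..1}" for t
  proof -
    have "((\<lambda>t. x t - (a * int_cosh \<theta> t - b * int_sinh \<theta> t)) has_real_derivative 0)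
        (at s within {0..1})" if "s \<in> {0..1}" for s
      using u[OF that]
      by (auto intro!: derivative_eq_intros dx[OF that] int_cosh_deriv int_sinh_deriv)
    from eq_initial_value[OF this t] show "x t = a * int_cosh \<theta> t - b * int_sinh \<theta> t"
      by (simp add: init)
    have "((\<lambda>t. y t - (b * int_cosh \<theta> t - a * int_sinh \<theta> t)) has_real_derivative 0)
        (at s within {0..1})" if "s \<in> {0..1}" for s
      using v[OF that]
      by (auto intro!: derivative_eq_intros dy[OF that] int_cosh_deriv int_sinh_deriv)
    from eq_initial_value[OF this t] show "y t = b * int_cosh \<theta> t - a * int_sinh \<theta> t"
      by (simp add: init)
  qed
  have z: "z t = (b\<^sup>2 - a\<^sup>2) * area_coeff \<theta> t" if t: "t \<in> {0..1}" for t
  proof -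
    have "((\<lambda>t. z t - (b\<^sup>2 - a\<^sup>2) * area_coeff \<theta> t) has_real_derivative 0) (at s within {0..1})"
      if s: "s \<in> {0..1}" for s
    proof -
      have area: "(u s * y s - v s * x s) / 2 = - (b\<^sup>2 - a\<^sup>2) * int_sinh \<theta> s / 2"
        unfolding u[OF s] v[OF s] x[OF s] y[OF s] by (rule area_velocity[OF int_sinh_wronskian])
      show ?thesis
        by (auto intro!: derivative_eq_intros dz[OF s, unfolded area] area_coeff_deriv
            simp: field_simps)
    qed
    from eq_initial_value[OF this t] show ?thesis by (simp add: init)
  qed
  show thesis
    by (rule that[of \<theta> a b]) (simp add: \<gamma> x y z heis_geodesic_def)
qed

section \<open>Geodesics with a given end point\<close>

lemma linear_system_iff:
  fixes a b i j x y :: real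
  assumes "i\<^sup>2 - j\<^sup>2 \<noteq> 0"
  shows "a * i - b * j = x \<and> b * i - a * j = y \<longleftrightarrow>
    a = (x * i + y * j) / (i\<^sup>2 - j\<^sup>2) \<and> b = (y * i + x * j) / (i\<^sup>2 - j\<^sup>2)"
proof -
  have "a * i - b * j = x \<and> b * i - a * j = y \<longleftrightarrow>
    a * (i\<^sup>2 - j\<^sup>2) = x * i + y * j \<and> b * (i\<^sup>2 - j\<^sup>2) = y * i + x * j"
    using assms by algebra
  then show ?thesis using assms by (simp add: field_simps)
qed

lemma normsq_end_point:
  fixes a b i j x y :: real
  assumes "a * i - b * j = x" "b * i - a * j = y"
  shows "- (x\<^sup>2) + y\<^sup>2 = (b\<^sup>2 - a\<^sup>2) * (i\<^sup>2 - j\<^sup>2)"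
  unfolding assms[symmetric] by (simp add: algebra_simps power2_eq_square)

text \<open>The three end-point equations decouple: the ratio 4z / (-x^2 + y^2) constrains only
  \<theta>, and for given \<theta> the first two coordinates determine (a, b) by Cramer's
  rule.\<close>

lemma heis_geodesic_end_point_iff:
  fixes \<theta> x y z :: real
  defines "K \<equiv> (int_cosh \<theta> 1)\<^sup>2 - (int_sinh \<theta> 1)\<^sup>2"
  assumes "0 < - (x\<^sup>2) + y\<^sup>2"
  shows "heis_geodesic \<theta> a b 1 = (x, y, z) \<longleftrightarrow>
    4 * z / (- (x\<^sup>2) + y\<^sup>2) = end_ratio \<theta> \<and>
    a = (x * int_cosh \<theta> 1 + y * int_sinh \<theta> 1) / K \<and>
    b = (y * int_cosh \<theta> 1 + x * int_sinh \<theta> 1) / K"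
proof -
  have K: "0 < K" unfolding K_def by (rule int_det_pos)
  have "(b\<^sup>2 - a\<^sup>2) * area_coeff \<theta> 1 = z \<longleftrightarrow> 4 * z / (- (x\<^sup>2) + y\<^sup>2) = end_ratio \<theta>"
    if "a * int_cosh \<theta> 1 - b * int_sinh \<theta> 1 = x" "b * int_cosh \<theta> 1 - a * int_sinh \<theta> 1 = y"
  proof -
    have N: "- (x\<^sup>2) + y\<^sup>2 = (b\<^sup>2 - a\<^sup>2) * K"
      unfolding K_def using normsq_end_point[OF that] .
    with assms(2) K have ne: "b\<^sup>2 - a\<^sup>2 \<noteq> 0" by force
    have r: "end_ratio \<theta> = 4 * area_coeff \<theta> 1 / K"
      unfolding K_def by (rule area_coeff_ratio[symmetric])
    \<comment> \<open>Here e stands for b^2 - a^2, which is nonzero because -x^2 + y^2 is positive,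
      and so it can be cancelled.\<close>
    have "e * c = z \<longleftrightarrow> 4 * z / (e * K) = 4 * c / K" if "e \<noteq> 0" for e c
      using that K by (auto simp: field_simps)
    then show ?thesis unfolding N r using ne by blast
  qed
  then show ?thesis
    unfolding heis_geodesic_def prod.inject
    using linear_system_iff[of "int_cosh \<theta> 1" "int_sinh \<theta> 1" a b x y] K
    unfolding K_def by auto
qed

lemma speed_end_point:
  assumes "heis_geodesic \<theta> a b 1 = (x, y, z)"
  shows "- (x\<^sup>2) + y\<^sup>2 = (b\<^sup>2 - a\<^sup>2) * ((int_cosh \<theta> 1)\<^sup>2 - (int_sinh \<theta> 1)\<^sup>2)"
  using assms by (intro normsq_end_point) (auto simp: heis_geodesic_def)

lemma spacelike_curve_heis_geodesic:
  assumes "a\<^sup>2 < b\<^sup>2"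
  shows "spacelike_curve (heis_geodesic \<theta> a b)"
  unfolding spacelike_curve_def spacelike_vector_def
  using heis_geodesic_deriv heis_velocity_horizontal lorentz_heis_velocity assms
  by (metis diff_gt_0_iff_gt)

text \<open>The speed is constant, so the integral over the unit interval is its value. The
  derivatives are taken within that interval, where \<gamma> is known to agree with the explicit
  curve.\<close>

lemma curve_length_heis_geodesic:
  assumes "\<And>t. t \<in> {0..1} \<Longrightarrow> \<gamma> t = heis_geodesic \<theta> a b t"
  shows "(curve_length \<gamma>)\<^sup>2 = \<bar>b\<^sup>2 - a\<^sup>2\<bar>"
proof -
  have "vector_derivative \<gamma> (at t within {0..1}) = heis_velocity \<theta> a b t" if "t \<in> {0..1}" for t
  proof (rule vector_derivative_within_closed_interval)
    show "(\<gamma> has_vector_derivative heis_velocity \<theta> a b t) (at t within {0..1})"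
      using that assms heis_geodesic_deriv by (rule has_vector_derivative_transform)
  qed (use that in auto)
  then have "curve_length \<gamma> = integral {0..1::real} (\<lambda>t. sqrt \<bar>b\<^sup>2 - a\<^sup>2\<bar>)"
    unfolding curve_length_def by (intro integral_cong) (simp add: lorentz_heis_velocity)
  then show ?thesis by simp
qed

lemma unique_parameters:
  assumes "0 < - (x\<^sup>2) + y\<^sup>2" "spacelike_geodesic_joining (0, 0, 0) (x, y, z) \<gamma>"
    and "4 * z / (- (x\<^sup>2) + y\<^sup>2) = end_ratio \<theta>"
  obtains a b where "\<And>t. t \<in> {0..1} \<Longrightarrow> \<gamma> t = heis_geodesic \<theta> a b t"
    and "heis_geodesic \<theta> a b 1 = (x, y, z)"
proof -
  from assms(2) have \<gamma>: "geodesic \<gamma>" "\<gamma> 0 = (0, 0, 0)" "\<gamma> 1 = (x, y, z)"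
    unfolding spacelike_geodesic_joining_def by auto
  obtain \<theta>' a b where eq: "\<And>t. t \<in> {0..1} \<Longrightarrow> \<gamma> t = heis_geodesic \<theta>' a b t"
    using geodesic_from_origin[OF \<gamma>(1,2)] by blast
  have one: "heis_geodesic \<theta>' a b 1 = (x, y, z)" using eq[of 1] \<gamma>(3) by simp
  then have "end_ratio \<theta>' = end_ratio \<theta>"
    using heis_geodesic_end_point_iff[OF assms(1)] assms(3) by metis
  then have "\<theta>' = \<theta>" using inj_end_ratio by (simp add: inj_eq)
  with that eq one show thesis by blast
qed

text \<open>Surjectivity of \<open>end_ratio\<close> supplies \<theta>, and the linear system then
  supplies (a, b). Uniqueness is equality on [0, 1], since joining curves are unconstrained
  elsewhere.\<close>

lemma unique_spacelike_geodesic: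
  assumes "0 < - (x\<^sup>2) + y\<^sup>2" "-1 < 4 * z / (- (x\<^sup>2) + y\<^sup>2)" "4 * z / (- (x\<^sup>2) + y\<^sup>2) < 1"
  shows "\<exists>\<gamma>. spacelike_geodesic_joining (0, 0, 0) (x, y, z) \<gamma> \<and>
    (\<forall>\<gamma>'. spacelike_geodesic_joining (0, 0, 0) (x, y, z) \<gamma>' \<longrightarrow> (\<forall>t\<in>{0..1}. \<gamma>' t = \<gamma> t))"
proof -
  obtain \<theta> where \<theta>: "4 * z / (- (x\<^sup>2) + y\<^sup>2) = end_ratio \<theta>"
    using end_ratio_onto[OF assms(2,3)] by metis
  define K where "K = (int_cosh \<theta> 1)\<^sup>2 - (int_sinh \<theta> 1)\<^sup>2"
  define a where "a = (x * int_cosh \<theta> 1 + y * int_sinh \<theta> 1) / K"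
  define b where "b = (y * int_cosh \<theta> 1 + x * int_sinh \<theta> 1) / K"
  have one_iff: "heis_geodesic \<theta> a' b' 1 = (x, y, z) \<longleftrightarrow> a' = a \<and> b' = b" for a' b'
    using heis_geodesic_end_point_iff[OF assms(1), of \<theta> a' b' z] \<theta> by (simp add: a_def b_def K_def)
  then have one: "heis_geodesic \<theta> a b 1 = (x, y, z)" by simp
  \<comment> \<open>The product equals -x^2 + y^2. Since the determinant K is positive, the end
    point forces the constant squared speed to be positive.\<close>
  have "0 < (b\<^sup>2 - a\<^sup>2) * K"
    using speed_end_point[OF one] assms(1) by (simp add: K_def)
  then have "a\<^sup>2 < b\<^sup>2"
    using int_det_pos[of \<theta>] by (simp add: K_def zero_less_mult_iff)
  then have "spacelike_geodesic_joining (0, 0, 0) (x, y, z) (heis_geodesic \<theta> a b)"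
    unfolding spacelike_geodesic_joining_def
    using geodesic_heis_geodesic spacelike_curve_heis_geodesic one by (simp add: heis_geodesic_def)
  moreover have "\<gamma>' t = heis_geodesic \<theta> a b t"
    if "spacelike_geodesic_joining (0, 0, 0) (x, y, z) \<gamma>'" "t \<in> {0..1}" for \<gamma>' t
    using unique_parameters[OF assms(1) that(1) \<theta>] that(2) one_iff by metis
  ultimately show ?thesis by blast
qed

section \<open>Closed formulas for the curve and its length\<close>

lemma end_ratio_half:
  assumes "\<theta> \<noteq> 0"
  shows "end_ratio \<theta> = (\<theta> / 2) / (sinh (\<theta> / 2))\<^sup>2 - coth (\<theta> / 2)"
  using assms unfolding end_ratio_def cosh_minus_one_half coth_def sinh_half[of \<theta>]
  by (simp add: field_simps power2_eq_square)

lemma heis_geodesic_explicit: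
  assumes "0 < \<theta>" and one: "heis_geodesic \<theta> a b 1 = (x, y, z)"
  shows "heis_geodesic \<theta> a b t =
    ((sinh (\<theta>/2 * t))\<^sup>2 * (x * (coth (\<theta>/2 * t) * coth (\<theta>/2) - 1) + y * (coth (\<theta>/2 * t) - coth (\<theta>/2))),
     (sinh (\<theta>/2 * t))\<^sup>2 * (y * (coth (\<theta>/2 * t) * coth (\<theta>/2) - 1) + x * (coth (\<theta>/2 * t) - coth (\<theta>/2))),
     z * ((\<theta> * t - sinh (\<theta> * t)) / (\<theta> - sinh \<theta>)))"
proof -
  define p where "p = \<theta> / 2"
  have p: "0 < p" and \<theta>: "\<theta> = 2 * p" using assms(1) by (auto simp: p_def)
  \<comment> \<open>Passing to p = \<theta>/2 turns both integrals into products with the common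
    factor sinh (p t), which produces the sinh^2 and coth of the final formulas.\<close>
  have i: "int_cosh \<theta> t = sinh (p * t) * cosh (p * t) / p"
    and j: "int_sinh \<theta> t = (sinh (p * t))\<^sup>2 / p" for t
    using p sinh_half[of "\<theta> * t"] cosh_minus_one_half[of "\<theta> * t"]
    by (simp_all add: int_cosh_def int_sinh_def \<theta> field_simps)
  let ?s = "sinh p" and ?c = "cosh p"
  have s: "0 < ?s" using p by simp
  have x: "x = ?s * (a * ?c - b * ?s) / p" and y: "y = ?s * (b * ?c - a * ?s) / p"
    using one i[of 1] j[of 1] p
    by (auto simp: heis_geodesic_def power2_eq_square right_diff_distrib diff_divide_distrib mult_ac)
  have C: "?c * ?c = 1 + ?s * ?s" using cosh_square_eq[of p] by (simp add: power2_eq_square)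
  \<comment> \<open>These combinations invert the hyperbolic rotation by p, isolating a and
    b.\<close>
  have "x * ?c + y * ?s = a * ?s / p" "y * ?c + x * ?s = b * ?s / p"
    unfolding x y using p by (simp_all add: field_simps) (use C in algebra)+
  then have a: "a = p * (x * ?c + y * ?s) / ?s" and b: "b = p * (y * ?c + x * ?s) / ?s"
    using p s by (simp_all add: field_simps)
  \<comment> \<open>This also covers t = 0: there \<open>coth\<close> has the default value 0 and
    both sides vanish.\<close>
  have coth: "(sinh (p * t))\<^sup>2 * coth (p * t) = sinh (p * t) * cosh (p * t)"
    by (simp add: coth_def power2_eq_square)
  have 1: "a * int_cosh \<theta> t - b * int_sinh \<theta> t =
    (sinh (p * t))\<^sup>2 * (x * (coth (p * t) * coth p - 1) + y * (coth (p * t) - coth p))"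
  proof -
    have "a * int_cosh \<theta> t - b * int_sinh \<theta> t =
      (sinh (p * t) * cosh (p * t)) * (x * coth p + y) - (sinh (p * t))\<^sup>2 * (x + y * coth p)"
      unfolding i j a b using p s by (simp add: coth_def[of p] field_simps)
    then show ?thesis unfolding coth[symmetric] by (simp add: algebra_simps)
  qed
  have 2: "b * int_cosh \<theta> t - a * int_sinh \<theta> t =
    (sinh (p * t))\<^sup>2 * (y * (coth (p * t) * coth p - 1) + x * (coth (p * t) - coth p))"
  proof -
    have "b * int_cosh \<theta> t - a * int_sinh \<theta> t =
      (sinh (p * t) * cosh (p * t)) * (y * coth p + x) - (sinh (p * t))\<^sup>2 * (y + x * coth p)"
      unfolding i j a b using p s by (simp add: coth_def[of p] field_simps)
    then show ?thesis unfolding coth[symmetric] by (simp add: algebra_simps)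
  qed
  \<comment> \<open>The end value z eliminates b^2 - a^2 from z(t); the quotient is legitimate
    because sinh \<theta> > \<theta>.\<close>
  have "z = (b\<^sup>2 - a\<^sup>2) * ((\<theta> - sinh \<theta>) / (2 * \<theta>\<^sup>2))"
    using one by (simp add: heis_geodesic_def area_coeff_def)
  then have 3: "(b\<^sup>2 - a\<^sup>2) * area_coeff \<theta> t = z * ((\<theta> * t - sinh (\<theta> * t)) / (\<theta> - sinh \<theta>))"
    using less_sinh[OF assms(1)] by (simp add: area_coeff_def)
  show ?thesis unfolding heis_geodesic_def 1 2 3 p_def by simp
qed

text \<open>Both -x^2 + y^2 and 4|z| are b^2 - a^2 times an explicit function of \<theta>. Adding
  them reproduces the denominator of the claimed formula up to the factor \<theta>^2, so the
  quotient returns b^2 - a^2.\<close>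

lemma speed_explicit:
  assumes "0 < \<theta>" and one: "heis_geodesic \<theta> a b 1 = (x, y, z)" and N: "0 < - (x\<^sup>2) + y\<^sup>2"
  shows "\<bar>b\<^sup>2 - a\<^sup>2\<bar> = \<theta>\<^sup>2 * ((- (x\<^sup>2) + y\<^sup>2 + 4 * \<bar>z\<bar>) /
    (2 * (\<bar>\<theta> - sinh \<theta>\<bar> + 2 * (sinh (\<theta>/2))\<^sup>2)))"
proof -
  define e where "e = b\<^sup>2 - a\<^sup>2"
  have C: "1 < cosh \<theta>" and S: "\<theta> < sinh \<theta>"
    using assms(1) cosh_gt_one[of \<theta>] less_sinh[of \<theta>] by auto
  have Ne: "- (x\<^sup>2) + y\<^sup>2 = e * (2 * (cosh \<theta> - 1) / \<theta>\<^sup>2)"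
    using speed_end_point[OF one] int_det_eq[of \<theta>] assms(1) by (simp add: e_def)
  then have e: "0 < e" using N C assms(1) by (simp add: zero_less_mult_iff zero_less_divide_iff)
  have "z = e * ((\<theta> - sinh \<theta>) / (2 * \<theta>\<^sup>2))"
    using one by (simp add: heis_geodesic_def area_coeff_def e_def)
  \<comment> \<open>For \<theta> > 0 the height z is negative, so |z| is obtained by reversing the
    difference.\<close>
  then have "z = - (e * ((sinh \<theta> - \<theta>) / (2 * \<theta>\<^sup>2)))"
    by (metis minus_diff_eq minus_divide_left mult_minus_right)
  moreover have "0 < e * ((sinh \<theta> - \<theta>) / (2 * \<theta>\<^sup>2))" using e S assms(1) by simp
  ultimately have z: "\<bar>z\<bar> = e * ((sinh \<theta> - \<theta>) / (2 * \<theta>\<^sup>2))" by linarith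
  define D where "D = sinh \<theta> - \<theta> + (cosh \<theta> - 1)"
  have D: "0 < D" using C S by (simp add: D_def)
  have "\<theta>\<^sup>2 * (- (x\<^sup>2) + y\<^sup>2 + 4 * \<bar>z\<bar>) = e * (2 * D)"
    unfolding Ne z D_def using assms(1) by (simp add: field_simps)
  moreover have "\<bar>\<theta> - sinh \<theta>\<bar> + 2 * (sinh (\<theta>/2))\<^sup>2 = D"
    using S cosh_minus_one_half[of \<theta>] by (simp add: D_def)
  ultimately show ?thesis using D e by (simp add: e_def)
qed

theorem theorem4:
  fixes x y z :: real
  assumes "- (x\<^sup>2) + y\<^sup>2 > 0"
    and "-1 < 4 * z / (- (x\<^sup>2) + y\<^sup>2)"
    and "4 * z / (- (x\<^sup>2) + y\<^sup>2) < 1"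
  shows "(\<exists>\<gamma>. spacelike_geodesic_joining (0, 0, 0) (x, y, z) \<gamma> \<and>
            (\<forall>\<gamma>'. spacelike_geodesic_joining (0, 0, 0) (x, y, z) \<gamma>' \<longrightarrow>
                  (\<forall>t\<in>{0..1}. \<gamma>' t = \<gamma> t))) \<and>
    (\<forall>\<theta>::real. \<theta> \<noteq> 0 \<and>
       4 * z / (- (x\<^sup>2) + y\<^sup>2) = (\<bar>\<theta>\<bar>/2) / (sinh (\<bar>\<theta>\<bar>/2))\<^sup>2 - coth (\<bar>\<theta>\<bar>/2) \<longrightarrow>
       (\<forall>\<gamma>. spacelike_geodesic_joining (0, 0, 0) (x, y, z) \<gamma> \<longrightarrow>
          (\<forall>t\<in>{0..1}. \<gamma> t =
             ((sinh (\<bar>\<theta>\<bar>/2 * t))\<^sup>2 *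
                (x * (coth (\<bar>\<theta>\<bar>/2 * t) * coth (\<bar>\<theta>\<bar>/2) - 1)
                 + y * (coth (\<bar>\<theta>\<bar>/2 * t) - coth (\<bar>\<theta>\<bar>/2))),
              (sinh (\<bar>\<theta>\<bar>/2 * t))\<^sup>2 *
                (y * (coth (\<bar>\<theta>\<bar>/2 * t) * coth (\<bar>\<theta>\<bar>/2) - 1)
                 + x * (coth (\<bar>\<theta>\<bar>/2 * t) - coth (\<bar>\<theta>\<bar>/2))),
              z * ((\<bar>\<theta>\<bar> * t - sinh (\<bar>\<theta>\<bar> * t)) / (\<bar>\<theta>\<bar> - sinh \<bar>\<theta>\<bar>)))) \<and>
          h_normsq (\<gamma> 1) = - (x\<^sup>2) + y\<^sup>2 \<and>
          (curve_length \<gamma>)\<^sup>2 =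
             \<theta>\<^sup>2 * ((h_normsq (\<gamma> 1) + 4 * \<bar>z\<bar>) /
                   (2 * (\<bar>\<bar>\<theta>\<bar> - sinh \<bar>\<theta>\<bar>\<bar> + 2 * (sinh (\<bar>\<theta>\<bar>/2))\<^sup>2)))))"
proof (intro conjI allI impI)
  show "\<exists>\<gamma>. spacelike_geodesic_joining (0, 0, 0) (x, y, z) \<gamma> \<and>
    (\<forall>\<gamma>'. spacelike_geodesic_joining (0, 0, 0) (x, y, z) \<gamma>' \<longrightarrow> (\<forall>t\<in>{0..1}. \<gamma>' t = \<gamma> t))"
    by (rule unique_spacelike_geodesic[OF assms])
next
  fix \<theta> :: real and \<gamma>
  assume \<theta>: "\<theta> \<noteq> 0 \<and>
    4 * z / (- (x\<^sup>2) + y\<^sup>2) = (\<bar>\<theta>\<bar>/2) / (sinh (\<bar>\<theta>\<bar>/2))\<^sup>2 - coth (\<bar>\<theta>\<bar>/2)"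
    and \<gamma>: "spacelike_geodesic_joining (0, 0, 0) (x, y, z) \<gamma>"
  have pos: "0 < \<bar>\<theta>\<bar>" using \<theta> by simp
  \<comment> \<open>The half-argument form of the ratio identifies |\<theta>| as the parameter of
    the geodesic. As |\<theta>| > 0, the ratio is negative, so the equation can only hold for z <
    0.\<close>
  have "4 * z / (- (x\<^sup>2) + y\<^sup>2) = end_ratio \<bar>\<theta>\<bar>" using \<theta> by (simp add: end_ratio_half)
  then obtain a b where eq: "\<And>t. t \<in> {0..1} \<Longrightarrow> \<gamma> t = heis_geodesic \<bar>\<theta>\<bar> a b t"
    and one: "heis_geodesic \<bar>\<theta>\<bar> a b 1 = (x, y, z)"
    using unique_parameters[OF assms(1) \<gamma>] by blast
  show "\<forall>t\<in>{0..1}. \<gamma> t =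
    ((sinh (\<bar>\<theta>\<bar>/2 * t))\<^sup>2 *
       (x * (coth (\<bar>\<theta>\<bar>/2 * t) * coth (\<bar>\<theta>\<bar>/2) - 1) + y * (coth (\<bar>\<theta>\<bar>/2 * t) - coth (\<bar>\<theta>\<bar>/2))),
     (sinh (\<bar>\<theta>\<bar>/2 * t))\<^sup>2 *
       (y * (coth (\<bar>\<theta>\<bar>/2 * t) * coth (\<bar>\<theta>\<bar>/2) - 1) + x * (coth (\<bar>\<theta>\<bar>/2 * t) - coth (\<bar>\<theta>\<bar>/2))),
     z * ((\<bar>\<theta>\<bar> * t - sinh (\<bar>\<theta>\<bar> * t)) / (\<bar>\<theta>\<bar> - sinh \<bar>\<theta>\<bar>)))"
    using eq heis_geodesic_explicit[OF pos one] by metis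
  show normsq: "h_normsq (\<gamma> 1) = - (x\<^sup>2) + y\<^sup>2"
    using \<gamma> by (simp add: spacelike_geodesic_joining_def h_normsq_def)
  have "(curve_length \<gamma>)\<^sup>2 = \<bar>b\<^sup>2 - a\<^sup>2\<bar>" using eq by (rule curve_length_heis_geodesic)
  also have "\<dots> = \<bar>\<theta>\<bar>\<^sup>2 * ((- (x\<^sup>2) + y\<^sup>2 + 4 * \<bar>z\<bar>) /
      (2 * (\<bar>\<bar>\<theta>\<bar> - sinh \<bar>\<theta>\<bar>\<bar> + 2 * (sinh (\<bar>\<theta>\<bar>/2))\<^sup>2)))"
    by (rule speed_explicit[OF pos one assms(1)])
  finally show "(curve_length \<gamma>)\<^sup>2 = \<theta>\<^sup>2 * ((h_normsq (\<gamma> 1) + 4 * \<bar>z\<bar>) /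
      (2 * (\<bar>\<bar>\<theta>\<bar> - sinh \<bar>\<theta>\<bar>\<bar> + 2 * (sinh (\<bar>\<theta>\<bar>/2))\<^sup>2)))"
    by (simp add: normsq)
qed

end
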